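(* Let $\mathcal D\subseteq\mathcal R^{vNM}$ be a domain satisfying (R1), (R2) and (R3), and let $f\colon\mathcal D^N\to\mathcal R^{vNM}$ be an anonymous Arrovian social welfare function (with range $\mathcal R^{vNM}$). Then $\mathcal D\subseteq\mathcal R^{dich}$.
   Context: Outcomes. $\mathcal U$ is a non-empty finite set of alternatives; $\Delta$ is the set of all probability measures on $\mathcal U$. Each $a\in\mathcal U$ is identified with the point mass on $a$. For $X\subseteq\mathcal U$, $\Delta_X=\{p\in\Delta: p(X)=1\}$. Preferences. A preference relation is an asymmetric binary relation $\succ$ on $\Delta$; $p\sim q$ means neither $p\succ q$ nor $q\succ p$; $p\succsim q$ means $p\succ q$ or $p\sim q$. For a set $X$ of outcomes, ${\succ}|_X=\{(p,q)\in{\succ}: p,q\in X\}$. $\mathcal R^{vNM}$ is the set of preference relations $\succ$ for which there is a linear function $u\colon\Delta\to\mathbb R$ (i.e. $u(p)=\sum_{a\in\mathcal U}p(a)u(a)$) with $p\succ q\Leftrightarrow u(p)>u(q)$ for all $p,q\in\Delta$. $\mathcal R^{dich}$ is the set of those ${\succ}\in\mathcal R^{vNM}$ for which $u$ can be chosen with $u(a)\in\{0,1\}$ for all $a\in\mathcal U$ (this includes the empty relation $\emptyset$, complete indifference). Social welfare functions. $N=\{1,\dots,n\}$ with $n\ge2$ is the set of agents. A profile is $R=(\succ_1,\dots,\succ_n)\in\mathcal D^N$; restrictions $R|_X$ are componentwise. A social welfare function (SWF) with range $\mathcal R^{vNM}$ is a map $f\colon\mathcal D^N\to\mathcal R^{vNM}$.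 It satisfies Pareto optimality if for all $p,q\in\Delta$, $R\in\mathcal D^N$ and ${\succ}=f(R)$: $p\succsim_iq$ for all $i\in N$ implies $p\succsim q$, and if additionally $p\succ_iq$ for some $i$ then $p\succ q$. It satisfies IIA if for all $R,\hat R\in\mathcal D^N$ and $X\subseteq\mathcal U$: $R|_{\Delta_X}=\hat R|_{\Delta_X}$ implies $f(R)|_{\Delta_X}=f(\hat R)|_{\Delta_X}$. It is Arrovian if it satisfies Pareto optimality and IIA. It is anonymous if $f(R)=f(R\circ\pi)$ for every $R\in\mathcal D^N$ and every permutation $\pi$ of $N$. Domain conditions. For a permutation $\pi$ of $\mathcal U$ and $p\in\Delta$, $p^\pi(\pi(a))=p(a)$; ${\succ}^\pi$ is defined by $p^\pi\succ^\pi q^\pi\Leftrightarrow p\succ q$. ${\succ}^{-1}$ is defined by $p\succ^{-1}q\Leftrightarrow q\succ p$. (R1) for every ${\succ}$ and every permutation $\pi$ of $\mathcal U$, ${\succ}\in\mathcal D$ if and only if ${\succ}^\pi\in\mathcal D$; (R2) $\emptyset\in\mathcal D$; (R3) ${\succ}\in\mathcal D$ implies ${\succ}^{-1}\in\mathcal D$. *)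

theory Defs
  imports "HOL-Probability.Probability" "HOL-Combinatorics.Permutations"
begin

text \<open>The finite non-empty set of alternatives is the type \<^typ>\<open>'a::finite\<close>; lotteries are the
  elements of \<^typ>\<open>'a pmf\<close>, and the alternative \<open>a\<close>, seen as a point mass, is
  \<open>return_pmf a\<close>. A pair \<open>(p, q)\<close> in a relation means that \<open>p\<close> is strictly preferred to \<open>q\<close>.\<close>

type_synonym 'a pref = "'a pmf rel"

definition lotteries_on :: "'a set \<Rightarrow> 'a pmf set" where
  "lotteries_on X = {p. measure_pmf.prob p X = 1}"

definition preference_relations :: "'a pref set" where
  "preference_relations = {P. asym P}"

definition indifferent :: "'a pref \<Rightarrow> 'a pmf \<Rightarrow> 'a pmf \<Rightarrow> bool" where
  "indifferent P p q \<longleftrightarrow> (p, q) \<notin> P \<and> (q, p) \<notin> P"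

definition weakly_prefers :: "'a pref \<Rightarrow> 'a pmf \<Rightarrow> 'a pmf \<Rightarrow> bool" where
  "weakly_prefers P p q \<longleftrightarrow> (p, q) \<in> P \<or> indifferent P p q"

definition linear_utility :: "('a::finite pmf \<Rightarrow> real) \<Rightarrow> bool" where
  "linear_utility u \<longleftrightarrow> (\<forall>p. u p = (\<Sum>a\<in>UNIV. pmf p a * u (return_pmf a)))"

definition represents :: "('a pmf \<Rightarrow> real) \<Rightarrow> 'a pref \<Rightarrow> bool" where
  "represents u P \<longleftrightarrow> (\<forall>p q. (p, q) \<in> P \<longleftrightarrow> u p > u q)"

definition vNM :: "'a::finite pref set" where
  "vNM = {P \<in> preference_relations. \<exists>u. linear_utility u \<and> represents u P}"

definition dichotomous :: "'a::finite pref set" where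
  "dichotomous = {P \<in> vNM. \<exists>u. linear_utility u \<and> represents u P \<and>
     (\<forall>a. u (return_pmf a) \<in> {0, 1})}"

definition restrict_pref :: "'a pref \<Rightarrow> 'a pmf set \<Rightarrow> 'a pref" where
  "restrict_pref P Y = {(p, q) \<in> P. p \<in> Y \<and> q \<in> Y}"

text \<open>\<open>map_pmf \<pi> p\<close> is the lottery \<open>p\<close> with alternatives relabelled by \<open>\<pi>\<close>; see the two lemmas
  below.\<close>

definition permute_pref :: "('a \<Rightarrow> 'a) \<Rightarrow> 'a pref \<Rightarrow> 'a pref" where
  "permute_pref \<pi> P = {(map_pmf \<pi> p, map_pmf \<pi> q) | p q. (p, q) \<in> P}"

lemma pmf_map_permutation:
  assumes "\<pi> permutes UNIV"
  shows "pmf (map_pmf \<pi> p) (\<pi> a) = pmf p a"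
  using permutes_inj[OF assms] by (rule pmf_map_inj')

lemma permute_pref_iff:
  assumes "\<pi> permutes UNIV"
  shows "(map_pmf \<pi> p, map_pmf \<pi> q) \<in> permute_pref \<pi> P \<longleftrightarrow> (p, q) \<in> P"
proof -
  have "map_pmf \<pi> p = map_pmf \<pi> p' \<Longrightarrow> p = p'" for p p'
    using pmf.inj_map[OF permutes_inj[OF assms]] by (rule injD)
  then show ?thesis
    unfolding permute_pref_def by blast
qed

definition neutral_domain :: "'a pref set \<Rightarrow> bool" where
  "neutral_domain D \<longleftrightarrow> (\<forall>P\<in>preference_relations. \<forall>\<pi>. \<pi> permutes UNIV \<longrightarrow>
     (P \<in> D \<longleftrightarrow> permute_pref \<pi> P \<in> D))"

text \<open>Profiles are extensional functions on \<open>{1..n}\<close>; \<open>R \<circ> \<pi>\<close> is again a profile when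
  \<open>\<pi> permutes {1..n}\<close>, since \<open>\<pi>\<close> then fixes everything outside \<open>{1..n}\<close>.\<close>

definition profiles :: "nat \<Rightarrow> 'a pref set \<Rightarrow> (nat \<Rightarrow> 'a pref) set" where
  "profiles n D = ({1..n} \<rightarrow>\<^sub>E D)"

definition pareto_optimal ::
    "nat \<Rightarrow> 'a pref set \<Rightarrow> ((nat \<Rightarrow> 'a pref) \<Rightarrow> 'a pref) \<Rightarrow> bool" where
  "pareto_optimal n D f \<longleftrightarrow> (\<forall>p q. \<forall>R\<in>profiles n D.
     (\<forall>i\<in>{1..n}. weakly_prefers (R i) p q) \<longrightarrow>
       weakly_prefers (f R) p q \<and> ((\<exists>i\<in>{1..n}. (p, q) \<in> R i) \<longrightarrow> (p, q) \<in> f R))"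

definition IIA ::
    "nat \<Rightarrow> 'a pref set \<Rightarrow> ((nat \<Rightarrow> 'a pref) \<Rightarrow> 'a pref) \<Rightarrow> bool" where
  "IIA n D f \<longleftrightarrow> (\<forall>R\<in>profiles n D. \<forall>R'\<in>profiles n D. \<forall>X.
     (\<forall>i\<in>{1..n}. restrict_pref (R i) (lotteries_on X) = restrict_pref (R' i) (lotteries_on X)) \<longrightarrow>
       restrict_pref (f R) (lotteries_on X) = restrict_pref (f R') (lotteries_on X))"

definition arrovian ::
    "nat \<Rightarrow> 'a pref set \<Rightarrow> ((nat \<Rightarrow> 'a pref) \<Rightarrow> 'a pref) \<Rightarrow> bool" where
  "arrovian n D f \<longleftrightarrow> pareto_optimal n D f \<and> IIA n D f"

definition anonymous ::
    "nat \<Rightarrow> 'a pref set \<Rightarrow> ((nat \<Rightarrow> 'a pref) \<Rightarrow> 'a pref) \<Rightarrow> bool" where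
  "anonymous n D f \<longleftrightarrow>
     (\<forall>R\<in>profiles n D. \<forall>\<pi>. \<pi> permutes {1..n} \<longrightarrow> f R = f (R \<circ> \<pi>))"

end

theory Submission imports Defs begin

text \<open>If \<open>P \<in> D\<close> is not dichotomous, its utility takes distinct values on some three alternatives.
  By (R1) all six strict rankings of these three alternatives then occur in \<open>D\<close>. A vNM preference
  restricted to the lotteries on a pair of alternatives is determined by the ranking of the pair, so
  IIA yields Arrow's pairwise independence on the triple. As in Arrow's theorem, a smallest decisive
  coalition is a singleton and is decisive on every pair of the triple. By anonymity two different
  singletons are decisive, which contradicts Pareto optimality.\<close>

section \<open>Order properties of vNM preferences, and lotteries on a pair\<close>

abbreviation prefers :: "'a pref \<Rightarrow> 'a \<Rightarrow> 'a \<Rightarrow> bool" where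
  "prefers P x y \<equiv> (return_pmf x, return_pmf y) \<in> P"

definition ranks :: "'a pref \<Rightarrow> 'a \<Rightarrow> 'a \<Rightarrow> 'a \<Rightarrow> bool" where
  "ranks P x y z \<longleftrightarrow> prefers P x y \<and> prefers P y z \<and> prefers P x z"

lemma vNM_obtain:
  assumes "P \<in> vNM"
  obtains u where "linear_utility u" "\<And>p q. (p, q) \<in> P \<longleftrightarrow> u p > u q"
  using assms by (auto simp: vNM_def represents_def)

lemma vNM_trans:
  assumes "P \<in> vNM" "(p, q) \<in> P" "(q, r) \<in> P"
  shows "(p, r) \<in> P"
  using assms by (auto elim!: vNM_obtain)

lemma vNM_asym:
  assumes "P \<in> vNM" "(p, q) \<in> P"
  shows "(q, p) \<notin> P"
  using assms by (auto elim!: vNM_obtain)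

lemma vNM_negatively_trans:
  assumes "P \<in> vNM" "(p, q) \<in> P" "(r, q) \<notin> P"
  shows "(p, r) \<in> P"
  using assms by (auto elim!: vNM_obtain)

text \<open>All mass of \<open>p\<close> lies on \<open>x\<close> and \<open>y\<close>, so the
  expectation has at most two terms and is affine in \<open>pmf p x\<close>. For
  \<open>x = y\<close> the slope is zero.\<close>

lemma linear_utility_on_pair:
  fixes u :: "'a::finite pmf \<Rightarrow> real"
  assumes "linear_utility u" "p \<in> lotteries_on {x, y}"
  shows "u p = u (return_pmf y) + pmf p x * (u (return_pmf x) - u (return_pmf y))"
proof -
  have one: "(\<Sum>a\<in>{x, y}. pmf p a) = 1"
    using assms(2) by (simp add: lotteries_on_def measure_measure_pmf_finite)
  have "set_pmf p \<subseteq> {x, y}"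
    using assms(2) measure_pmf.prob_eq_1[of "{x, y}" p]
    by (auto simp: lotteries_on_def AE_measure_pmf_iff)
  then have "pmf p a = 0" if "a \<notin> {x, y}" for a
    using that by (auto simp: set_pmf_eq)
  then have "(\<Sum>a\<in>UNIV. pmf p a * u (return_pmf a)) = (\<Sum>a\<in>{x, y}. pmf p a * u (return_pmf a))"
    by (intro sum.mono_neutral_right) auto
  then have "u p = (\<Sum>a\<in>{x, y}. pmf p a * u (return_pmf a))"
    using assms(1) unfolding linear_utility_def by metis
  moreover have "pmf p y = 1 - pmf p x" if "x \<noteq> y"
    using one that by simp
  ultimately show ?thesis
    using one by (cases "x = y") (simp_all add: algebra_simps)
qed

text \<open>By the affine formula, \<open>u p - u q\<close> is \<open>pmf p x - pmf q x\<close>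
  times \<open>u (return_pmf x) - u (return_pmf y)\<close>, so only the sign of the second factor
  matters.\<close>

lemma restrict_pref_pair:
  fixes P :: "'a::finite pref"
  assumes "P \<in> vNM"
  shows "restrict_pref P (lotteries_on {x, y}) =
    {(p, q). p \<in> lotteries_on {x, y} \<and> q \<in> lotteries_on {x, y} \<and>
       (pmf p x > pmf q x \<and> prefers P x y \<or> pmf p x < pmf q x \<and> prefers P y x)}"
proof -
  obtain u where u: "linear_utility u" "\<And>p q. (p, q) \<in> P \<longleftrightarrow> u p > u q"
    using assms by (rule vNM_obtain) auto
  have "(p, q) \<in> P \<longleftrightarrow>
      pmf p x > pmf q x \<and> prefers P x y \<or> pmf p x < pmf q x \<and> prefers P y x"
    if "p \<in> lotteries_on {x, y}" "q \<in> lotteries_on {x, y}" for p q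
    using linear_utility_on_pair[OF u(1) that(1)] linear_utility_on_pair[OF u(1) that(2)]
    by (auto simp: u(2) mult_less_cancel_right)
  then show ?thesis
    unfolding restrict_pref_def by blast
qed

section \<open>Profiles over a free triple and pairwise independence\<close>

locale arrovian_triple =
  fixes D :: "'a::finite pref set" and n :: nat and f :: "(nat \<Rightarrow> 'a pref) \<Rightarrow> 'a pref"
    and T :: "'a set"
  assumes two_agents: "n \<ge> 2"
    and domain_vNM: "D \<subseteq> vNM"
    and range_vNM: "f \<in> profiles n D \<rightarrow> vNM"
    and arrovian: "arrovian n D f"
    and card_T: "card T = 3"
    and free_triple: "\<lbrakk>distinct [x, y, z]; {x, y, z} \<subseteq> T\<rbrakk> \<Longrightarrow> \<exists>P\<in>D. ranks P x y z"
begin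

lemma profile_exists:
  assumes "\<And>i. i \<in> {1..n} \<Longrightarrow> \<exists>P\<in>D. \<phi> i P"
  obtains R where "R \<in> profiles n D" "\<forall>i\<in>{1..n}. \<phi> i (R i)"
proof -
  obtain g where "\<And>i. i \<in> {1..n} \<Longrightarrow> g i \<in> D \<and> \<phi> i (g i)"
    using assms by metis
  then show thesis
    by (intro that[of "restrict g {1..n}"]) (auto simp: profiles_def)
qed

text \<open>Builds the profiles in which one agent is set apart: \<open>i\<close> satisfies
  \<open>\<alpha>\<close> whether or not it belongs to \<open>S\<close>, and \<open>S\<close> only
  divides the remaining agents.\<close>

lemma profile_of_three_groups:
  assumes "\<exists>P\<in>D. \<alpha> P" "\<exists>P\<in>D. \<beta> P" "\<exists>P\<in>D. \<gamma> P" "i \<in> {1..n}"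
  obtains R where "R \<in> profiles n D" "\<alpha> (R i)"
    "\<forall>j\<in>{1..n}. j \<in> S \<longrightarrow> j \<noteq> i \<longrightarrow> \<beta> (R j)"
    "\<forall>j\<in>{1..n}. j \<notin> S \<longrightarrow> j \<noteq> i \<longrightarrow> \<gamma> (R j)"
proof -
  obtain A B C where "A \<in> D" "\<alpha> A" "B \<in> D" "\<beta> B" "C \<in> D" "\<gamma> C"
    using assms by blast
  then show thesis
    using assms(4)
    by (intro that[of "\<lambda>j\<in>{1..n}. if j = i then A else if j \<in> S then B else C"])
      (simp_all add: profiles_def)
qed

lemma profile_member_vNM: "\<lbrakk>R \<in> profiles n D; i \<in> {1..n}\<rbrakk> \<Longrightarrow> R i \<in> vNM"
  using domain_vNM by (auto simp: profiles_def)

lemma social_vNM: "R \<in> profiles n D \<Longrightarrow> f R \<in> vNM"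
  using range_vNM by auto

lemma unanimity:
  assumes "R \<in> profiles n D" "\<And>i. i \<in> {1..n} \<Longrightarrow> prefers (R i) x y"
  shows "prefers (f R) x y"
proof -
  have "1 \<in> {1..n}"
    using two_agents by simp
  with assms show ?thesis
    using arrovian unfolding arrovian_def pareto_optimal_def weakly_prefers_def by blast
qed

text \<open>Agreement on the ranking of \<open>x\<close> and \<open>y\<close> forces agreement on
  all lotteries over \<open>{x, y}\<close>, which is the premise of IIA; the conclusion is read off
  at the point masses.\<close>

lemma pairwise_independence:
  assumes R: "R \<in> profiles n D" and R': "R' \<in> profiles n D"
    and "\<And>i. i \<in> {1..n} \<Longrightarrow> prefers (R i) x y \<longleftrightarrow> prefers (R' i) x y"
    and "\<And>i. i \<in> {1..n} \<Longrightarrow> prefers (R i) y x \<longleftrightarrow> prefers (R' i) y x"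
  shows "prefers (f R) x y \<longleftrightarrow> prefers (f R') x y"
proof -
  have "restrict_pref (R i) (lotteries_on {x, y}) = restrict_pref (R' i) (lotteries_on {x, y})"
    if "i \<in> {1..n}" for i
    using that assms by (simp add: restrict_pref_pair profile_member_vNM)
  then have "restrict_pref (f R) (lotteries_on {x, y}) = restrict_pref (f R') (lotteries_on {x, y})"
    using arrovian R R' unfolding arrovian_def IIA_def by blast
  moreover have "return_pmf x \<in> lotteries_on {x, y}" "return_pmf y \<in> lotteries_on {x, y}"
    by (auto simp: lotteries_on_def)
  ultimately show ?thesis
    by (auto simp: restrict_pref_def set_eq_iff)
qed

section \<open>Decisive coalitions and their spread over the triple\<close>

definition splits :: "(nat \<Rightarrow> 'a pref) \<Rightarrow> nat set \<Rightarrow> 'a \<Rightarrow> 'a \<Rightarrow> bool" where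
  "splits R S x y \<longleftrightarrow> R \<in> profiles n D \<and>
     (\<forall>i\<in>{1..n}. if i \<in> S then prefers (R i) x y else prefers (R i) y x)"

text \<open>Only profiles in which every agent outside \<open>S\<close> strictly opposes are tested:
  this is almost decisiveness in Arrow's theorem.\<close>

definition decisive :: "nat set \<Rightarrow> 'a \<Rightarrow> 'a \<Rightarrow> bool" where
  "decisive S x y \<longleftrightarrow> (\<forall>R. splits R S x y \<longrightarrow> prefers (f R) x y)"

lemma decisiveD: "\<lbrakk>decisive S x y; splits R S x y\<rbrakk> \<Longrightarrow> prefers (f R) x y"
  by (simp add: decisive_def)

text \<open>One witness profile suffices: by asymmetry, two profiles split in the same way agree on
  the pair in both directions, so pairwise independence transfers the social ranking.\<close>

lemma decisiveI:
  assumes "splits R S x y" "prefers (f R) x y"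
  shows "decisive S x y"
  unfolding decisive_def
proof (intro allI impI)
  fix R' assume R': "splits R' S x y"
  have profs: "R \<in> profiles n D" "R' \<in> profiles n D"
    using assms R' by (auto simp: splits_def)
  have "(prefers (R i) x y \<longleftrightarrow> prefers (R' i) x y) \<and> (prefers (R i) y x \<longleftrightarrow> prefers (R' i) y x)"
    if "i \<in> {1..n}" for i
  proof -
    have "if i \<in> S then prefers (R i) x y \<and> prefers (R' i) x y
      else prefers (R i) y x \<and> prefers (R' i) y x"
      using assms(1) R' that by (auto simp: splits_def split: if_splits)
    then show ?thesis
      using vNM_asym profile_member_vNM[OF profs(1) that] profile_member_vNM[OF profs(2) that]
      by (auto split: if_splits)
  qed
  then show "prefers (f R') x y"
    using pairwise_independence[OF profs, of x y] assms(2) by blast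
qed

text \<open>Everyone ranks \<open>y\<close> over \<open>z\<close> and \<open>S\<close> enforces
  \<open>x\<close> over \<open>y\<close>, so society ranks \<open>x\<close> over \<open>z\<close>
  although all outside \<open>S\<close> rank \<open>z\<close> over \<open>x\<close>.\<close>

lemma decisive_replace_right:
  assumes "decisive S x y" "distinct [x, y, z]" "{x, y, z} \<subseteq> T"
  shows "decisive S x z"
proof -
  obtain R where R: "R \<in> profiles n D"
    "\<forall>i\<in>{1..n}. if i \<in> S then ranks (R i) x y z else ranks (R i) y z x"
    using assms(2,3) free_triple[of x y z] free_triple[of y z x]
    by (rule_tac profile_exists[of "\<lambda>i P. if i \<in> S then ranks P x y z else ranks P y z x"]) auto
  have "prefers (f R) y z"
    using R by (intro unanimity) (auto simp: ranks_def split: if_splits)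
  moreover have "prefers (f R) x y"
    using R by (intro decisiveD[OF assms(1)]) (auto simp: splits_def ranks_def split: if_splits)
  ultimately have "prefers (f R) x z"
    using vNM_trans social_vNM R(1) by blast
  then show ?thesis
    using R by (intro decisiveI[of R]) (auto simp: splits_def ranks_def split: if_splits)
qed

text \<open>Dual argument: everyone ranks \<open>z\<close> over \<open>x\<close>, and
  \<open>S\<close> enforces \<open>x\<close> over \<open>y\<close> while the others rank
  \<open>y\<close> over \<open>z\<close>.\<close>

lemma decisive_replace_left:
  assumes "decisive S x y" "distinct [x, y, z]" "{x, y, z} \<subseteq> T"
  shows "decisive S z y"
proof -
  obtain R where R: "R \<in> profiles n D"
    "\<forall>i\<in>{1..n}. if i \<in> S then ranks (R i) z x y else ranks (R i) y z x"
    using assms(2,3) free_triple[of z x y] free_triple[of y z x]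
    by (rule_tac profile_exists[of "\<lambda>i P. if i \<in> S then ranks P z x y else ranks P y z x"]) (auto split: if_splits)
  have "prefers (f R) z x"
    using R by (intro unanimity) (auto simp: ranks_def split: if_splits)
  moreover have "prefers (f R) x y"
    using R by (intro decisiveD[OF assms(1)]) (auto simp: splits_def ranks_def split: if_splits)
  ultimately have "prefers (f R) z y"
    using vNM_trans social_vNM R(1) by blast
  then show ?thesis
    using R by (intro decisiveI[of R]) (auto simp: splits_def ranks_def split: if_splits)
qed

text \<open>Split off one agent \<open>i\<close> from a smallest decisive coalition \<open>S\<close> and use the Condorcet profile:
  \<open>i\<close> ranks \<open>x, y, z\<close>, the rest of \<open>S\<close> ranks \<open>z, x, y\<close>, and everyone else ranks \<open>y, z, x\<close>. Since
  \<open>S - {i}\<close> is not decisive for \<open>z\<close> over \<open>y\<close>, agent \<open>i\<close> alone enforces \<open>x\<close> over \<open>z\<close>.\<close>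

lemma decisive_singleton:
  obtains i x y z where "i \<in> {1..n}" "distinct [x, y, z]" "{x, y, z} \<subseteq> T" "decisive {i} x y"
proof -
  define Q where
    "Q = (\<lambda>S. S \<subseteq> {1..n} \<and> (\<exists>x y. x \<in> T \<and> y \<in> T \<and> x \<noteq> y \<and> decisive S x y))"
  obtain a b c where abc: "distinct [a, b, c]" "T = {a, b, c}"
    using card_T by (auto simp: card_3_iff)
  \<comment> \<open>Pareto optimality makes the set of all agents decisive, so a decisive coalition
    of least size exists.\<close>
  have "decisive {1..n} a b"
    by (auto simp: decisive_def splits_def intro: unanimity)
  then have "Q {1..n}"
    using abc by (auto simp: Q_def)
  then obtain S where "Q S" and minimal: "\<And>S'. Q S' \<Longrightarrow> card S \<le> card S'"
    using ex_has_least_nat[of Q "{1..n}" card] by blast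
  then obtain x y where S: "S \<subseteq> {1..n}" "x \<in> T" "y \<in> T" "x \<noteq> y" "decisive S x y"
    unfolding Q_def by blast
  then obtain z where "z \<in> T" "z \<noteq> x" "z \<noteq> y"
    using abc by auto
  with S have xyz: "distinct [x, y, z]" "{x, y, z} \<subseteq> T"
    by auto
  \<comment> \<open>An empty decisive coalition would overrule a unanimous ranking of
    \<open>y\<close> over \<open>x\<close>.\<close>
  have "S \<noteq> {}"
  proof
    assume "S = {}"
    obtain R where R: "R \<in> profiles n D" "\<forall>i\<in>{1..n}. ranks (R i) y x z"
      using xyz free_triple[of y x z] by (rule_tac profile_exists[of "\<lambda>i P. ranks P y x z"]) auto
    then have "prefers (f R) y x"
      by (auto simp: ranks_def intro: unanimity)
    moreover have "prefers (f R) x y"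
      using R \<open>S = {}\<close> by (intro decisiveD[OF S(5)]) (auto simp: splits_def ranks_def)
    ultimately show False
      using vNM_asym social_vNM R(1) by blast
  qed
  then obtain i where i: "i \<in> S"
    by blast
  have "\<not> decisive (S - {i}) z y"
  proof
    assume "decisive (S - {i}) z y"
    then have "Q (S - {i})"
      using S xyz by (auto simp: Q_def)
    then show False
      using minimal i S(1) card_Diff1_less[of S i] finite_subset[of S "{1..n}"] by fastforce
  qed
  have "\<exists>P\<in>D. ranks P x y z" "\<exists>P\<in>D. ranks P z x y" "\<exists>P\<in>D. ranks P y z x" "i \<in> {1..n}"
    using xyz i S(1) by (auto intro!: free_triple)
  then obtain R where R: "R \<in> profiles n D" "ranks (R i) x y z"
    "\<forall>j\<in>{1..n}. j \<in> S \<longrightarrow> j \<noteq> i \<longrightarrow> ranks (R j) z x y"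
    "\<forall>j\<in>{1..n}. j \<notin> S \<longrightarrow> j \<noteq> i \<longrightarrow> ranks (R j) y z x"
    by (rule profile_of_three_groups[where S = S])
  have "prefers (f R) x y"
    using R i by (intro decisiveD[OF S(5)]) (auto simp: splits_def ranks_def)
  moreover have "splits R (S - {i}) z y"
    using R by (auto simp: splits_def ranks_def)
  then have "\<not> prefers (f R) z y"
    using decisiveI \<open>\<not> decisive (S - {i}) z y\<close> by blast
  \<comment> \<open>Negative transitivity: society ranks \<open>x\<close> over \<open>y\<close> but
    not \<open>z\<close> over \<open>y\<close>.\<close>
  ultimately have "prefers (f R) x z"
    using vNM_negatively_trans social_vNM R(1) by blast
  \<comment> \<open>In \<open>R\<close>, agent \<open>i\<close> alone ranks \<open>x\<close> over
    \<open>z\<close>; both other groups rank \<open>z\<close> over \<open>x\<close>.\<close>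
  then have "decisive {i} x z"
    using R by (intro decisiveI[of R]) (auto simp: splits_def ranks_def)+
  then show thesis
    using i S(1) xyz by (intro that[of i x z y]) auto
qed

section \<open>Anonymity against a single decisive agent\<close>

text \<open>Exchanging \<open>i\<close> and \<open>j\<close> turns a profile split by
  \<open>{j}\<close> into one split by \<open>{i}\<close>, and anonymity keeps the social preference
  fixed.\<close>

lemma decisive_transpose:
  assumes "anonymous n D f" "i \<in> {1..n}" "j \<in> {1..n}" "decisive {i} x y"
  shows "decisive {j} x y"
  unfolding decisive_def
proof (intro allI impI)
  fix R assume R: "splits R {j} x y"
  let ?\<pi> = "Transposition.transpose i j"
  have \<pi>: "?\<pi> permutes {1..n}"
    using assms by (intro permutes_swap_id) auto
  then have "?\<pi> k \<in> {1..n} \<longleftrightarrow> k \<in> {1..n}" for k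
    by (rule permutes_in_image)
  moreover have "?\<pi> k = j \<longleftrightarrow> k = i" for k
    by (auto simp: Transposition.transpose_def)
  moreover have "?\<pi> k = k" if "k \<notin> {1..n}" for k
    using \<pi> that by (rule permutes_not_in)
  ultimately have "splits (R \<circ> ?\<pi>) {i} x y"
    using R assms(3) by (auto simp: splits_def profiles_def PiE_iff extensional_def)
  then have "prefers (f (R \<circ> ?\<pi>)) x y"
    using assms(4) by (rule decisiveD[rotated])
  then show "prefers (f R) x y"
    using assms(1) \<pi> R by (auto simp: anonymous_def splits_def)
qed

theorem not_anonymous: "\<not> anonymous n D f"
proof
  assume anon: "anonymous n D f"
  obtain i x y z where i: "i \<in> {1..n}" and xyz: "distinct [x, y, z]" "{x, y, z} \<subseteq> T"
    and dec: "decisive {i} x y"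
    by (rule decisive_singleton)
  define j where "j = (if i = 1 then 2 else 1 :: nat)"
  have j: "j \<in> {1..n}" "j \<noteq> i"
    using two_agents by (auto simp: j_def)
  \<comment> \<open>Two replacements lead from \<open>x\<close> over \<open>y\<close> to
    \<open>y\<close> over \<open>z\<close>, a pair that can close a cycle.\<close>
  have "decisive {i} x z"
    using decisive_replace_right[OF dec] xyz by blast
  then have "decisive {i} y z"
    using xyz decisive_replace_left[of "{i}" x z y] by auto
  then have dec': "decisive {j} y z"
    using decisive_transpose[OF anon i j(1)] by blast
  \<comment> \<open>In the profile chosen next, only \<open>i\<close> ranks \<open>x\<close> over
    \<open>y\<close>, only \<open>j\<close> ranks \<open>y\<close> over \<open>z\<close>, and all
    rank \<open>z\<close> over \<open>x\<close>; society thus inherits a cycle.\<close>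
  have "\<exists>P\<in>D. ranks P z x y" "\<exists>P\<in>D. ranks P y z x" "\<exists>P\<in>D. ranks P z y x"
    using xyz by (auto intro!: free_triple)
  then obtain R where R: "R \<in> profiles n D" "ranks (R i) z x y"
    "\<forall>k\<in>{1..n}. k \<in> {j} \<longrightarrow> k \<noteq> i \<longrightarrow> ranks (R k) y z x"
    "\<forall>k\<in>{1..n}. k \<notin> {j} \<longrightarrow> k \<noteq> i \<longrightarrow> ranks (R k) z y x"
    using i by (rule profile_of_three_groups[where S = "{j}"])
  have "prefers (f R) x y"
    using R j by (intro decisiveD[OF dec]) (auto simp: splits_def ranks_def)
  moreover have "prefers (f R) y z"
    using R j by (intro decisiveD[OF dec']) (auto simp: splits_def ranks_def)
  moreover have "prefers (f R) z x"
    using R by (intro unanimity) (auto simp: ranks_def)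
  ultimately show False
    using vNM_trans vNM_asym social_vNM R(1) by blast
qed

end

section \<open>Non-dichotomous preferences and relabelling of triples\<close>

text \<open>Probabilities sum to 1, so the shift by \<open>c\<close> commutes with taking
  expectations.\<close>

lemma linear_utility_affine:
  fixes u :: "'a::finite pmf \<Rightarrow> real"
  assumes "linear_utility u"
  shows "linear_utility (\<lambda>p. (u p - c) / d)"
  unfolding linear_utility_def
proof
  fix p :: "'a pmf"
  have "(\<Sum>a\<in>UNIV. pmf p a * ((u (return_pmf a) - c) / d)) =
      ((\<Sum>a\<in>UNIV. pmf p a * u (return_pmf a)) - (\<Sum>a\<in>UNIV. pmf p a) * c) / d"
    by (simp add: sum_distrib_right sum_subtractf right_diff_distrib diff_divide_distrib
        sum_divide_distrib)
  also have "(\<Sum>a\<in>UNIV. pmf p a) = 1"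
    by (rule sum_pmf_eq_1) auto
  also have "(\<Sum>a\<in>UNIV. pmf p a * u (return_pmf a)) = u p"
    using assms unfolding linear_utility_def by metis
  finally show "(u p - c) / d = (\<Sum>a\<in>UNIV. pmf p a * ((u (return_pmf a) - c) / d))"
    by simp
qed

text \<open>The increasing affine map taking \<open>lo\<close> to 0 and \<open>hi\<close> to 1
  preserves the order. The two values need not both be attained, which covers constant
  utilities.\<close>

lemma dichotomous_if_two_values:
  fixes u :: "'a::finite pmf \<Rightarrow> real"
  assumes P: "P \<in> vNM" and u: "linear_utility u" "represents u P"
    and two_values: "\<And>a. u (return_pmf a) \<in> {lo, hi}" and "lo < hi"
  shows "P \<in> dichotomous"
proof -
  let ?v = "\<lambda>p. (u p - lo) / (hi - lo)"
  have "represents ?v P"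
    using u(2) \<open>lo < hi\<close> by (simp add: represents_def divide_less_cancel)
  moreover have "?v (return_pmf a) \<in> {0, 1}" for a
    using two_values[of a] \<open>lo < hi\<close> by auto
  ultimately show ?thesis
    using P linear_utility_affine[OF u(1)] unfolding dichotomous_def by blast
qed

text \<open>If the utility took only its minimum and maximum on alternatives, \<open>P\<close> would
  be dichotomous; a third value lies strictly between and supplies \<open>b\<close>.\<close>

lemma not_dichotomous_ranks:
  fixes P :: "'a::finite pref"
  assumes P: "P \<in> vNM" "P \<notin> dichotomous"
  obtains a b c where "ranks P a b c"
proof -
  obtain u where u: "linear_utility u" "\<And>p q. (p, q) \<in> P \<longleftrightarrow> u p > u q"
    using P(1) by (rule vNM_obtain) auto
  define w where "w = (\<lambda>a. u (return_pmf a))"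
  define hi lo where "hi = Max (range w)" and "lo = Min (range w)"
  have bounds: "lo \<le> w a" "w a \<le> hi" for a
    by (auto simp: hi_def lo_def)
  have "hi \<in> range w" "lo \<in> range w"
    unfolding hi_def lo_def by (rule Max_in Min_in; simp)+
  then obtain a c where a: "w a = hi" and c: "w c = lo"
    by auto
  have "\<exists>b. w b \<noteq> lo \<and> w b \<noteq> hi"
  proof (rule ccontr)
    assume "\<nexists>b. w b \<noteq> lo \<and> w b \<noteq> hi"
    then have two: "\<And>b. u (return_pmf b) \<in> {lo, hi}"
      by (auto simp: w_def)
    \<comment> \<open>if \<open>w\<close> is constant, \<open>lo + 1\<close> serves as the second value\<close>
    have "\<exists>hi'>lo. \<forall>b. u (return_pmf b) \<in> {lo, hi'}"
    proof (cases "lo = hi")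
      case True
      with two show ?thesis by (intro exI[of _ "lo + 1"]) auto
    next
      case False
      then have "lo < hi" using bounds[of a] by simp
      with two show ?thesis by blast
    qed
    then have "P \<in> dichotomous"
      using dichotomous_if_two_values[OF P(1) u(1)] u(2) by (auto simp: represents_def)
    with P(2) show False ..
  qed
  then obtain b where "w b \<noteq> lo" "w b \<noteq> hi" by blast
  then have "lo < w b" "w b < hi"
    using bounds[of b] by auto
  then have "ranks P a b c"
    using a c by (auto simp: ranks_def u(2) w_def)
  then show thesis by (rule that)
qed

text \<open>The complements of the two triples have equal finite size, so some bijection between
  them can be glued to the prescribed one.\<close>

lemma permutation_of_triple:
  assumes "distinct [a, b, c]" "distinct [x, y, z]"
  obtains \<pi> :: "'a::finite \<Rightarrow> 'a"
  where "\<pi> permutes UNIV" "\<pi> a = x" "\<pi> b = y" "\<pi> c = z"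
proof -
  define g where "g = (\<lambda>d. if d = a then x else if d = b then y else z)"
  have g: "bij_betw g {a, b, c} {x, y, z}"
    using assms by (auto simp: bij_betw_def inj_on_def g_def)
  have "card (- {a, b, c}) = card (- {x, y, z})"
    using assms by (simp add: Compl_eq_Diff_UNIV card_Diff_subset)
  then obtain h where h: "bij_betw h (- {a, b, c}) (- {x, y, z})"
    using finite_same_card_bij by (metis finite)
  let ?\<pi> = "\<lambda>d. if d \<in> {a, b, c} then g d else h d"
  have "bij_betw ?\<pi> ({a, b, c} \<union> - {a, b, c}) ({x, y, z} \<union> - {x, y, z})"
    using g h by (rule bij_betw_disjoint_Un) auto
  then have "?\<pi> permutes UNIV"
    by (intro bij_imp_permutes) (auto simp: Compl_partition)
  then show thesis
    using assms by (intro that[of ?\<pi>]) (auto simp: g_def)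
qed

theorem theorem3:
  fixes D :: "'a::finite pref set"
    and n :: nat
    and f :: "(nat \<Rightarrow> 'a pref) \<Rightarrow> 'a pref"
  assumes "n \<ge> 2"
    and "D \<subseteq> vNM"
    and R1: "neutral_domain D"
    and R2: "{} \<in> D"
    and R3: "\<And>P. P \<in> D \<Longrightarrow> P\<inverse> \<in> D"
    and "f \<in> profiles n D \<rightarrow> vNM"
    and "arrovian n D f"
    and "anonymous n D f"
  shows "D \<subseteq> dichotomous"
proof
  fix P assume "P \<in> D"
  then have P: "P \<in> vNM"
    using assms(2) by auto
  show "P \<in> dichotomous"
  proof (rule ccontr)
    assume "P \<notin> dichotomous"
    with P obtain a b c where abc: "ranks P a b c"
      by (rule not_dichotomous_ranks)
    then have dist: "distinct [a, b, c]"
      using vNM_asym[OF P] by (auto simp: ranks_def)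
    \<comment> \<open>Relabelling by (R1) carries the ranking of \<open>a\<close>, \<open>b\<close>,
      \<open>c\<close> to any distinct triple, in particular to every reordering of
      \<open>a\<close>, \<open>b\<close>, \<open>c\<close>.\<close>
    have "\<exists>Q\<in>D. ranks Q x y z" if xyz: "distinct [x, y, z]" for x y z
    proof -
      obtain \<pi> where \<pi>: "\<pi> permutes UNIV" "\<pi> a = x" "\<pi> b = y" "\<pi> c = z"
        using dist xyz by (rule permutation_of_triple)
      have "permute_pref \<pi> P \<in> D"
        using R1 P \<pi>(1) \<open>P \<in> D\<close> by (auto simp: neutral_domain_def vNM_def)
      moreover have "prefers (permute_pref \<pi> P) (\<pi> d) (\<pi> e) \<longleftrightarrow> prefers P d e" for d e
        using permute_pref_iff[OF \<pi>(1), of "return_pmf d" "return_pmf e"] by simp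
      then have "ranks (permute_pref \<pi> P) x y z"
        using abc unfolding ranks_def \<pi>(2-4)[symmetric] by simp
      ultimately show ?thesis by blast
    qed
    then interpret arrovian_triple D n f "{a, b, c}"
      using assms(1,2,6,7) dist by unfold_locales auto
    show False
      using not_anonymous assms(8) by blast
  qed
qed

end
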